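(* Let $(X,\tau)$ be a topological space and let $A\subseteq X$ with $A\notin\tau$. For each $x\in A\setminus \operatorname{Int}(A)$ let $U_x\in\tau(x)$ be arbitrary, and let $\mathcal{I}_A$ be the ideal on $X$ generated by the family $\{U_x\setminus A : x\in A\setminus\operatorname{Int}(A)\}$. Let $\tau^{*}$ be the topology of the ideal topological space $(X,\tau,\mathcal{I}_A)$. Then $A\in\tau^{*}$.
   Context: $\tau(x)=\{U\in\tau : x\in U\}$ is the family of open neighbourhoods of $x$; $\operatorname{Int}$ denotes interior in $\tau$. An ideal on $X$ is a nonempty family of subsets of $X$ closed under subsets and finite unions; the ideal generated by a family consists of all subsets of finite unions of members of the family. For an ideal $\mathcal{I}$ on $X$ and $B\subseteq X$, the local function is $B^{*}=\{x\in X : U\cap B\notin\mathcal{I}\text{ for every }U\in\tau(x)\}$. The map $\operatorname{Cl}^{*}(B)=B\cup B^{*}$ is a closure operator, and $\tau^{*}$ is the topology on $X$ with this closure operator; the family $\{V\setminus I : V\in\tau, I\in\mathcal{I}\}$ is a base of $\tau^{*}$. *)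

theory Defs
  imports "HOL-Analysis.Analysis"
begin

definition ideal_on :: "'a set \<Rightarrow> 'a set set \<Rightarrow> bool" where
  "ideal_on X I \<longleftrightarrow> I \<noteq> {} \<and> I \<subseteq> Pow X \<and>
     (\<forall>B\<in>I. \<forall>C. C \<subseteq> B \<longrightarrow> C \<in> I) \<and> (\<forall>B\<in>I. \<forall>C\<in>I. B \<union> C \<in> I)"

definition generated_ideal :: "'a set set \<Rightarrow> 'a set set" where
  "generated_ideal F = {B. \<exists>G. finite G \<and> G \<subseteq> F \<and> B \<subseteq> \<Union>G}"

definition local_function :: "'a topology \<Rightarrow> 'a set set \<Rightarrow> 'a set \<Rightarrow> 'a set" where
  "local_function T I B = {x \<in> topspace T. \<forall>U. openin T U \<and> x \<in> U \<longrightarrow> U \<inter> B \<notin> I}"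

definition cl_star :: "'a topology \<Rightarrow> 'a set set \<Rightarrow> 'a set \<Rightarrow> 'a set" where
  "cl_star T I B = B \<union> local_function T I B"

(* A set is open iff its complement is a fixed point of cl_star. For an ideal I on the
   underlying space this is the topology whose closure operator is cl_star:
   see openin_star_topology and closure_of_star_topology below. *)
definition star_topology :: "'a topology \<Rightarrow> 'a set set \<Rightarrow> 'a topology" where
  "star_topology T I =
     topology (\<lambda>W. W \<subseteq> topspace T \<and> cl_star T I (topspace T - W) = topspace T - W)"

lemma ideal_on_generated_ideal:
  assumes "F \<subseteq> Pow X"
  shows "ideal_on X (generated_ideal F)"
  unfolding ideal_on_def
proof (intro conjI ballI allI impI)
  have "{} \<in> generated_ideal F"
    unfolding generated_ideal_def by (auto intro: exI[of _ "{}"])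
  then show "generated_ideal F \<noteq> {}" by blast
  show "generated_ideal F \<subseteq> Pow X"
    unfolding generated_ideal_def using assms by blast
next
  fix B C assume "B \<in> generated_ideal F" "C \<subseteq> B"
  then show "C \<in> generated_ideal F"
    unfolding generated_ideal_def by blast
next
  fix B C assume "B \<in> generated_ideal F" "C \<in> generated_ideal F"
  then obtain G H where "finite G" "G \<subseteq> F" "B \<subseteq> \<Union>G" "finite H" "H \<subseteq> F" "C \<subseteq> \<Union>H"
    unfolding generated_ideal_def by blast
  then have "finite (G \<union> H)" "G \<union> H \<subseteq> F" "B \<union> C \<subseteq> \<Union>(G \<union> H)" by auto
  then show "B \<union> C \<in> generated_ideal F"
    unfolding generated_ideal_def by blast
qed

lemma ideal_onD_subset: "ideal_on X I \<Longrightarrow> B \<in> I \<Longrightarrow> C \<subseteq> B \<Longrightarrow> C \<in> I"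
  unfolding ideal_on_def by simp

lemma ideal_onD_Un: "ideal_on X I \<Longrightarrow> B \<in> I \<Longrightarrow> C \<in> I \<Longrightarrow> B \<union> C \<in> I"
  unfolding ideal_on_def by simp

lemma ideal_onD_empty: "ideal_on X I \<Longrightarrow> {} \<in> I"
  unfolding ideal_on_def by (metis empty_subsetI ex_in_conv)

lemma local_function_mono:
  assumes "ideal_on (topspace T) I" "B \<subseteq> C"
  shows "local_function T I B \<subseteq> local_function T I C"
proof
  fix x assume x: "x \<in> local_function T I B"
  have "U \<inter> C \<notin> I" if U: "openin T U" "x \<in> U" for U
  proof
    assume "U \<inter> C \<in> I"
    moreover have "U \<inter> B \<subseteq> U \<inter> C" using assms(2) by blast
    ultimately have "U \<inter> B \<in> I" by (rule ideal_onD_subset[OF assms(1)])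
    then show False using x U unfolding local_function_def by blast
  qed
  then show "x \<in> local_function T I C" using x unfolding local_function_def by blast
qed

lemma local_function_empty:
  assumes "ideal_on (topspace T) I"
  shows "local_function T I {} = {}"
proof -
  have "{} \<in> I" using assms by (rule ideal_onD_empty)
  then show ?thesis unfolding local_function_def by auto
qed

lemma local_function_Un:
  assumes "ideal_on (topspace T) I"
  shows "local_function T I (B \<union> C) = local_function T I B \<union> local_function T I C"
proof
  show "local_function T I B \<union> local_function T I C \<subseteq> local_function T I (B \<union> C)"
    by (intro Un_least local_function_mono[OF assms]) auto
  show "local_function T I (B \<union> C) \<subseteq> local_function T I B \<union> local_function T I C"
  proof (rule ccontr)
    assume "\<not> ?thesis"
    then obtain x U V where x: "x \<in> local_function T I (B \<union> C)"
      and U: "openin T U" "x \<in> U" "U \<inter> B \<in> I" and V: "openin T V" "x \<in> V" "V \<inter> C \<in> I"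
      unfolding local_function_def by blast
    have "(U \<inter> B) \<union> (V \<inter> C) \<in> I" using U(3) V(3) by (rule ideal_onD_Un[OF assms])
    moreover have "(U \<inter> V) \<inter> (B \<union> C) \<subseteq> (U \<inter> B) \<union> (V \<inter> C)" by blast
    ultimately have "(U \<inter> V) \<inter> (B \<union> C) \<in> I"
      by (rule ideal_onD_subset[OF assms])
    moreover have "openin T (U \<inter> V)" "x \<in> U \<inter> V" using U V by auto
    ultimately show False using x unfolding local_function_def by blast
  qed
qed

lemma local_function_idem:
  "local_function T I (local_function T I B) \<subseteq> local_function T I B"
  if "ideal_on (topspace T) I"
proof
  fix x assume x: "x \<in> local_function T I (local_function T I B)"
  have "U \<inter> B \<notin> I" if U: "openin T U" "x \<in> U" for U
  proof -
    have "{} \<in> I" using \<open>ideal_on (topspace T) I\<close> by (rule ideal_onD_empty)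
    then have "U \<inter> local_function T I B \<noteq> {}"
      using x U unfolding local_function_def by fastforce
    then show ?thesis using U unfolding local_function_def by blast
  qed
  then show "x \<in> local_function T I B" using x unfolding local_function_def by blast
qed

lemma openin_star_topology:
  assumes I: "ideal_on (topspace T) I"
  shows "openin (star_topology T I) W \<longleftrightarrow>
    W \<subseteq> topspace T \<and> cl_star T I (topspace T - W) = topspace T - W"
proof -
  let ?X = "topspace T"
  let ?P = "\<lambda>W. W \<subseteq> ?X \<and> cl_star T I (?X - W) = ?X - W"
  have eq: "?P W \<longleftrightarrow> W \<subseteq> ?X \<and> local_function T I (?X - W) \<subseteq> ?X - W" for W
    unfolding cl_star_def by blast
  have "istopology ?P"
    unfolding istopology_def
  proof (intro conjI allI impI)
    fix S R assume SR: "?P S" "?P R"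
    have "?X - (S \<inter> R) = (?X - S) \<union> (?X - R)" by blast
    then have "cl_star T I (?X - (S \<inter> R)) = cl_star T I (?X - S) \<union> cl_star T I (?X - R)"
      using local_function_Un[OF I] unfolding cl_star_def by auto
    then show "S \<inter> R \<subseteq> ?X" "cl_star T I (?X - (S \<inter> R)) = ?X - (S \<inter> R)"
      using SR by auto
  next
    fix K assume K: "\<forall>k\<in>K. ?P k"
    have sub: "local_function T I (?X - \<Union>K) \<subseteq> ?X - k" if "k \<in> K" for k
    proof -
      have "local_function T I (?X - \<Union>K) \<subseteq> local_function T I (?X - k)"
        using that by (intro local_function_mono[OF I]) blast
      moreover have "local_function T I (?X - k) \<subseteq> ?X - k"
        using K that unfolding cl_star_def by blast
      ultimately show ?thesis by blast
    qed
    have "local_function T I (?X - \<Union>K) \<subseteq> ?X" unfolding local_function_def by blast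
    then have "?P (\<Union>K)" unfolding eq using sub K by blast
    then show "\<Union>K \<subseteq> ?X" "cl_star T I (?X - \<Union>K) = ?X - \<Union>K" by auto
  qed
  then show ?thesis
    unfolding star_topology_def by (simp add: topology_inverse')
qed

lemma topspace_star_topology:
  assumes "ideal_on (topspace T) I"
  shows "topspace (star_topology T I) = topspace T"
proof -
  have "openin (star_topology T I) (topspace T)"
    by (simp add: openin_star_topology[OF assms] cl_star_def local_function_empty[OF assms])
  then show ?thesis
    using openin_subset openin_topspace openin_star_topology[OF assms] by (intro subset_antisym) blast+
qed

lemma closure_of_star_topology:
  assumes I: "ideal_on (topspace T) I" and B: "B \<subseteq> topspace T"
  shows "star_topology T I closure_of B = cl_star T I B"
proof (rule closure_of_unique)
  let ?X = "topspace T"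
  have closed: "closedin (star_topology T I) C \<longleftrightarrow> C \<subseteq> ?X \<and> cl_star T I C = C" for C
    unfolding closedin_def topspace_star_topology[OF I] openin_star_topology[OF I]
    by (auto simp: double_diff)
  show "B \<subseteq> cl_star T I B" unfolding cl_star_def by blast
  have "cl_star T I (cl_star T I B) = cl_star T I B"
    using local_function_Un[OF I] local_function_idem[OF I] unfolding cl_star_def by blast
  then show "closedin (star_topology T I) (cl_star T I B)"
    using B unfolding closed cl_star_def local_function_def by blast
  show "cl_star T I B \<subseteq> C" if "B \<subseteq> C" "closedin (star_topology T I) C" for C
    using that local_function_mono[OF I \<open>B \<subseteq> C\<close>] unfolding closed cl_star_def by blast
qed

end

theory Submission
  imports Defs
begin

text \<open>A set is open in \<tau>* once each of its points x has a \<tau>-neighbourhood V that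
  leaves the set only by a member of the ideal (\<open>openin_star_topologyI\<close>). For A such a
  V is always at hand: at an interior point the interior of A, which does not leave A at all; at any
  other point of A the chosen \<open>U x\<close>, because \<open>U x - A\<close> is a generator of
  the ideal.\<close>

lemma generated_ideal_superset: "F \<subseteq> generated_ideal F"
proof
  fix B assume "B \<in> F"
  then have "finite {B} \<and> {B} \<subseteq> F \<and> B \<subseteq> \<Union>{B}" by simp
  then show "B \<in> generated_ideal F" unfolding generated_ideal_def by blast
qed

text \<open>In terms of the base of \<tau>*, removing the ideal member \<open>V - W\<close> from
  \<open>V\<close> leaves a basic open set containing x and contained in \<open>W\<close>. The proof
  argues with the closure instead: \<open>V\<close> keeps x out of the local function of the
  complement of \<open>W\<close>, so that complement is a fixed point of
  \<open>cl_star\<close>.\<close>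

lemma openin_star_topologyI:
  assumes I: "ideal_on (topspace T) I" and W: "W \<subseteq> topspace T"
    and nbhd: "\<And>x. x \<in> W \<Longrightarrow> \<exists>V. openin T V \<and> x \<in> V \<and> V - W \<in> I"
  shows "openin (star_topology T I) W"
proof -
  have "local_function T I (topspace T - W) \<subseteq> topspace T - W"
  proof
    fix x assume x: "x \<in> local_function T I (topspace T - W)"
    have "x \<notin> W"
    proof
      assume "x \<in> W"
      then obtain V where V: "openin T V" "x \<in> V" "V - W \<in> I"
        using nbhd by blast
      \<comment> \<open>The trace of \<open>V\<close> on the complement is thus in the ideal, which
        membership of x in the local function forbids.\<close>
      have "V \<inter> (topspace T - W) = V - W"
        using openin_subset[OF V(1)] by blast
      then show False using x V unfolding local_function_def by auto
    qed
    then show "x \<in> topspace T - W"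
      using x unfolding local_function_def by blast
  qed
  then show ?thesis
    unfolding openin_star_topology[OF I] cl_star_def using W by blast
qed

theorem proposition1:
  fixes T :: "'a topology" and A :: "'a set" and U :: "'a \<Rightarrow> 'a set"
  assumes "A \<subseteq> topspace T"
    and "\<not> openin T A"
    and "\<And>x. x \<in> A - T interior_of A \<Longrightarrow> openin T (U x) \<and> x \<in> U x"
  shows "openin (star_topology T (generated_ideal {U x - A | x. x \<in> A - T interior_of A})) A"
proof -
  let ?F = "{U x - A | x. x \<in> A - T interior_of A}"
  have "?F \<subseteq> Pow (topspace T)"
    using assms(3) openin_subset by blast
  then have I: "ideal_on (topspace T) (generated_ideal ?F)"
    by (rule ideal_on_generated_ideal)
  show ?thesis
  proof (rule openin_star_topologyI[OF I assms(1)])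
    fix x assume "x \<in> A"
    show "\<exists>V. openin T V \<and> x \<in> V \<and> V - A \<in> generated_ideal ?F"
    proof (cases "x \<in> T interior_of A")
      case True
      \<comment> \<open>Nothing is assumed about \<open>U x\<close> at interior points, so the
        interior itself serves as neighbourhood.\<close>
      have "T interior_of A - A = {}"
        by (simp add: interior_of_subset)
      then have "T interior_of A - A \<in> generated_ideal ?F"
        using ideal_onD_empty[OF I] by (simp only:)
      then show ?thesis using True openin_interior_of by blast
    next
      case False
      then have x: "x \<in> A - T interior_of A" using \<open>x \<in> A\<close> by blast
      then have "U x - A \<in> generated_ideal ?F"
        using generated_ideal_superset[of ?F] by blast
      then show ?thesis using assms(3)[OF x] by blast
    qed
  qed
qed

end
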